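(* Let $G$ be a finite, simple, connected graph and let $k$ be a positive integer such that $G$ has a $k$-core. Then $c_{cr}(G)\geq k$.
   Context: A $k$-core of a graph $G$ is a (nonempty) induced subgraph $H$ of $G$ whose minimum degree (computed in $H$) is at least $k$. Cheating Robot game on a finite, simple, connected graph $G$ with $k$ cops: first the cop player places $k$ cops on vertices of $G$, then the robot is placed on a vertex. A vertex may hold more than one token. Play then proceeds in rounds: in each round, first every cop moves to a vertex in its closed neighbourhood (so a cop may stay put), and then the robot, knowing the cops' moves, moves to a vertex in his closed neighbourhood (he may stay put). Both sides have perfect information about positions. The robot is captured if either (i) at the end of the robot's move a cop and the robot are on the same vertex, or (ii) on his move the robot traverses an edge that a cop traversed on the cops' immediately preceding move. (A cop moving onto the robot's vertex does not by itself end the game; the robot still gets his move.) The cops win if they capture the robot after finitely many rounds. $c_{cr}(G)$ is the least number of cops that have a strategy guaranteeing capture of the robot on $G$. *)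

theory Defs
  imports "Graph_Theory.Graph_Theory"
begin

text \<open>
  Finite simple graphs are the locale \<open>graph\<close> of \<open>Graph_Theory\<close>: finite symmetric digraphs without
  loops and parallel arcs. The degree of a vertex is then its \<open>out_degree\<close>, and \<open>connected\<close>
  includes that there is at least one vertex.
\<close>

definition min_degree :: "('a, 'b) pre_digraph \<Rightarrow> nat" where
  "min_degree H = Min (out_degree H ` verts H)"

definition is_core :: "nat \<Rightarrow> ('a, 'b) pre_digraph \<Rightarrow> ('a, 'b) pre_digraph \<Rightarrow> bool" where
  "is_core k H G \<longleftrightarrow> induced_subgraph H G \<and> verts H \<noteq> {} \<and> k \<le> min_degree H"

definition closed_nbhd :: "('a, 'b) pre_digraph \<Rightarrow> 'a \<Rightarrow> 'a set" where
  "closed_nbhd G v = insert v {u. v \<rightarrow>\<^bsub>G\<^esub> u}"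

text \<open>The list \<open>c\<close> holds the vertex \<open>c ! i\<close> of each of the \<open>n\<close> cops.\<close>

definition cop_placement :: "('a, 'b) pre_digraph \<Rightarrow> nat \<Rightarrow> 'a list \<Rightarrow> bool" where
  "cop_placement G n c \<longleftrightarrow> length c = n \<and> set c \<subseteq> verts G"

definition cop_move :: "('a, 'b) pre_digraph \<Rightarrow> 'a list \<Rightarrow> 'a list \<Rightarrow> bool" where
  "cop_move G c c' \<longleftrightarrow> length c' = length c \<and> (\<forall>i<length c. c' ! i \<in> closed_nbhd G (c ! i))"

definition traverses :: "'a \<Rightarrow> 'a \<Rightarrow> 'a \<Rightarrow> 'a \<Rightarrow> bool" where
  "traverses x x' u v \<longleftrightarrow> x \<noteq> x' \<and> {x, x'} = {u, v}"

text \<open>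
  Capture in a round in which the cops move from \<open>c\<close> to \<open>c'\<close> and then the robot from \<open>r\<close> to \<open>r'\<close>.
  An edge counts as traversed by both players regardless of the directions.
\<close>

definition captured :: "'a list \<Rightarrow> 'a list \<Rightarrow> 'a \<Rightarrow> 'a \<Rightarrow> bool" where
  "captured c c' r r' \<longleftrightarrow>
     r' \<in> set c' \<or>
     (\<exists>i<length c. \<exists>u v. traverses (c ! i) (c' ! i) u v \<and> traverses r r' u v)"

text \<open>
  A strategy maps the list of all positions (cops, robot) so far, the current one last, to the next
  placement of the cops.
\<close>

type_synonym 'a cop_strategy = "('a list \<times> 'a) list \<Rightarrow> 'a list"

definition legal_strategy :: "('a, 'b) pre_digraph \<Rightarrow> nat \<Rightarrow> 'a cop_strategy \<Rightarrow> bool" where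
  "legal_strategy G n \<sigma> \<longleftrightarrow>
     (\<forall>h c r. cop_placement G n c \<and> r \<in> verts G \<longrightarrow> cop_move G c (\<sigma> (h @ [(c, r)])))"

text \<open>
  \<open>C t\<close> and \<open>R t\<close> are the positions after round \<open>t\<close>, where \<open>t = 0\<close> is the initial placement.
  Plays are continued formally after a capture, which is harmless since only the existence of
  a capturing round matters below.
\<close>

definition play :: "('a, 'b) pre_digraph \<Rightarrow> 'a list \<Rightarrow> 'a cop_strategy \<Rightarrow>
    (nat \<Rightarrow> 'a list) \<Rightarrow> (nat \<Rightarrow> 'a) \<Rightarrow> bool" where
  "play G c0 \<sigma> C R \<longleftrightarrow>
     C 0 = c0 \<and> R 0 \<in> verts G \<and>
     (\<forall>t. C (Suc t) = \<sigma> (map (\<lambda>s. (C s, R s)) [0..<Suc t])) \<and>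
     (\<forall>t. R (Suc t) \<in> closed_nbhd G (R t))"

definition cops_win :: "('a, 'b) pre_digraph \<Rightarrow> nat \<Rightarrow> bool" where
  "cops_win G n \<longleftrightarrow>
     (\<exists>c0 \<sigma>. cop_placement G n c0 \<and> legal_strategy G n \<sigma> \<and>
        (\<forall>C R. play G c0 \<sigma> C R \<longrightarrow>
           (\<exists>t. captured (C t) (C (Suc t)) (R t) (R (Suc t)))))"

definition c_cr :: "('a, 'b) pre_digraph \<Rightarrow> nat" where
  "c_cr G = (LEAST n. cops_win G n)"

text \<open>The minimum is attained: with a cop staying on every vertex the robot is captured at once.\<close>

lemma cops_win_card_verts:
  assumes "graph G"
  shows "cops_win G (card (verts G))"
proof -
  interpret graph G by (rule assms)
  obtain c0 where c0: "set c0 = verts G" "length c0 = card (verts G)"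
    using finite_distinct_list[OF finite_verts] distinct_card by metis
  define \<sigma> :: "'a cop_strategy" where "\<sigma> = (\<lambda>h. fst (last h))"
  have "cop_placement G (card (verts G)) c0"
    using c0 by (simp add: cop_placement_def)
  moreover have "legal_strategy G (card (verts G)) \<sigma>"
    by (simp add: legal_strategy_def \<sigma>_def cop_move_def closed_nbhd_def)
  moreover have "captured (C 0) (C (Suc 0)) (R 0) (R (Suc 0))" if p: "play G c0 \<sigma> C R" for C R
  proof -
    have "C (Suc 0) = \<sigma> (map (\<lambda>s. (C s, R s)) [0..<Suc 0])" and C0: "C 0 = c0"
      using p unfolding play_def by blast+
    then have "C (Suc 0) = c0"
      by (simp add: \<sigma>_def)
    moreover have "R (Suc 0) \<in> verts G"
    proof -
      have "R 0 \<in> verts G" "R (Suc 0) \<in> closed_nbhd G (R 0)"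
        using p unfolding play_def by blast+
      then show ?thesis
        by (auto simp: closed_nbhd_def arcs_ends_conv)
    qed
    ultimately show ?thesis
      using c0 by (simp add: captured_def)
  qed
  ultimately show ?thesis
    unfolding cops_win_def by blast
qed

end

theory Submission
  imports Defs
begin

text \<open>
  Fewer than \<open>k\<close> cops cannot catch a robot that walks forever inside a \<open>k\<close>-core \<open>H\<close>. Suppose no cop
  is on the robot's vertex \<open>r\<close>, and let the cops move. A cop that does not end on \<open>r\<close> has used no
  edge at \<open>r\<close>, so it forbids at most one neighbour of \<open>r\<close>, namely its new vertex. A cop that ends
  on \<open>r\<close> came from some other vertex and has thereby used the edge to it, so it forbids staying at
  \<open>r\<close> and moving to that one vertex, and nothing else. Hence each cop forbids at most one neighbour of \<open>r\<close>. As \<open>r\<close> has at least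
  \<open>k\<close> neighbours in \<open>H\<close>, one of them remains safe (\<open>robot_evades_cops\<close>), and moving there restores the
  situation. The same count gives the robot a starting vertex in \<open>H\<close> without a cop. Iterating these
  moves against a given strategy yields a play without capture (\<open>not_cops_win_of_core\<close>).
\<close>

lemma (in nomulti_digraph) card_out_nbhd: "card {v. r \<rightarrow> v} = out_degree G r"
proof -
  have "inj_on (head G) (out_arcs G r)"
    using no_multi_arcs by (auto simp: inj_on_def arc_to_ends_def)
  moreover have "{v. r \<rightarrow> v} = head G ` out_arcs G r"
    by (auto simp: arcs_ends_conv)
  ultimately show ?thesis
    by (simp add: card_image out_degree_def)
qed

lemma (in digraph) core_degree:
  assumes "is_core k H G" and "r \<in> verts H"
  shows "k \<le> card {v. r \<rightarrow>\<^bsub>H\<^esub> v}"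
proof -
  have "subgraph H G" and k: "k \<le> Min (out_degree H ` verts H)"
    using assms(1) by (auto simp: is_core_def min_degree_def)
  then interpret H: digraph H
    by (simp add: digraph_subgraph)
  have "Min (out_degree H ` verts H) \<le> out_degree H r"
    using assms(2) by simp
  then show ?thesis
    using k by (simp add: H.card_out_nbhd)
qed

lemma (in wf_digraph) closed_nbhd_subset_verts:
  assumes "v \<in> verts G"
  shows "closed_nbhd G v \<subseteq> verts G"
  using assms by (auto simp: closed_nbhd_def dest: adj_in_verts)

lemma (in wf_digraph) cop_placement_cop_move:
  assumes "cop_placement G n c" and "cop_move G c c'"
  shows "cop_placement G n c'"
proof -
  have len: "length c' = length c" and "\<And>i. i < length c \<Longrightarrow> c' ! i \<in> closed_nbhd G (c ! i)"
    using assms(2) by (auto simp: cop_move_def)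
  moreover have "c ! i \<in> verts G" if "i < length c" for i
    using assms(1) that nth_mem unfolding cop_placement_def by blast
  ultimately have "c' ! i \<in> verts G" if "i < length c'" for i
    using that closed_nbhd_subset_verts by (metis subsetD)
  then show ?thesis
    using assms(1) len by (auto simp: cop_placement_def in_set_conv_nth)
qed

text \<open>
  The counting step needs no graph: \<open>N\<close> is any set of possible targets other than \<open>r\<close> that
  outnumbers the cops.
\<close>

lemma robot_evades_cops:
  assumes len: "length c' = length c" and r: "r \<notin> set c" "r \<notin> N"
    and card: "length c < card N"
  shows "\<exists>r'\<in>N. \<not> captured c c' r r'"
proof -
  \<comment> \<open>the one vertex other than \<open>r\<close> that cop \<open>i\<close> forbids\<close>
  define b where "b i = (if c' ! i = r then c ! i else c' ! i)" for i
  have "card (b ` {..<length c}) \<le> length c"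
    using card_image_le[of "{..<length c}" b] by simp
  then have "\<not> N \<subseteq> b ` {..<length c}"
    using card card_mono[of "b ` {..<length c}" N] by auto
  then obtain r' where r': "r' \<in> N" "\<And>i. i < length c \<Longrightarrow> r' \<noteq> b i"
    by auto
  have "r' \<noteq> r"
    using r' r by auto
  have "r' \<notin> set c'"
  proof
    assume "r' \<in> set c'"
    then obtain i where "i < length c" "c' ! i = r'"
      by (auto simp: in_set_conv_nth len)
    then show False
      using r'(2)[of i] \<open>r' \<noteq> r\<close> by (simp add: b_def)
  qed
  moreover have False
    if i: "i < length c" and t: "traverses (c ! i) (c' ! i) u v" "traverses r r' u v" for i u v
  proof -
    have "c ! i \<noteq> r"
      using r i by auto
    then have "c' ! i = r" "c ! i = r'"
      using t by (auto simp: traverses_def doubleton_eq_iff)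
    then show False
      using r'(2)[OF i] by (simp add: b_def)
  qed
  ultimately show ?thesis
    using r'(1) unfolding captured_def by blast
qed

text \<open>
  Any response rule \<open>f\<close> of the robot, which sees the current placement of the cops, his own vertex
  and the cops' next placement, determines a sequence of positions against a strategy \<open>\<sigma>\<close>.
\<close>

lemma positions_exist:
  fixes \<sigma> :: "'a cop_strategy"
  obtains C R where "C 0 = c0" "R 0 = r0"
    "\<And>t. C (Suc t) = \<sigma> (map (\<lambda>s. (C s, R s)) [0..<Suc t])"
    "\<And>t. R (Suc t) = f (C t) (R t) (C (Suc t))"
proof -
  \<comment> \<open>the list of positions up to round \<open>t\<close>, from which the two sequences are read off\<close>
  define h where "h = rec_nat [(c0, r0)]
    (\<lambda>_ h. h @ [(\<sigma> h, f (fst (last h)) (snd (last h)) (\<sigma> h))])"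
  define C R where "C t = fst (last (h t))" and "R t = snd (last (h t))" for t
  have h0: "h 0 = [(c0, r0)]"
    and hSuc: "\<And>t. h (Suc t) = h t @ [(\<sigma> (h t), f (C t) (R t) (\<sigma> (h t)))]"
    by (simp_all add: h_def C_def R_def)
  have CSuc: "C (Suc t) = \<sigma> (h t)" and RSuc: "R (Suc t) = f (C t) (R t) (\<sigma> (h t))" for t
    using hSuc[of t] by (simp_all add: C_def R_def)
  have "h t = map (\<lambda>s. (C s, R s)) [0..<Suc t]" for t
    by (induction t) (simp_all add: h0 hSuc CSuc RSuc, simp_all add: C_def R_def h0)
  then show ?thesis
    using that[of C R] CSuc RSuc by (simp add: C_def R_def h0)
qed

lemma (in digraph) not_cops_win_of_core:
  assumes core: "is_core k H G" and "n < k"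
  shows "\<not> cops_win G n"
proof
  assume "cops_win G n"
  then obtain c0 \<sigma> where c0: "cop_placement G n c0" and \<sigma>: "legal_strategy G n \<sigma>"
    and win: "\<And>C R. play G c0 \<sigma> C R \<Longrightarrow> \<exists>t. captured (C t) (C (Suc t)) (R t) (R (Suc t))"
    unfolding cops_win_def by blast
  define N where "N r = {v. r \<rightarrow>\<^bsub>H\<^esub> v}" for r
  have sub: "subgraph H G" and "verts H \<noteq> {}"
    using core by (auto simp: is_core_def induced_subgraph_def)
  then have vH: "verts H \<subseteq> verts G" and wfH: "wf_digraph H"
    by (auto simp: subgraph_def)
  have N_verts: "N r \<subseteq> verts H" for r
    using wf_digraph.adj_in_verts(2)[OF wfH] by (auto simp: N_def)
  have N_adj: "r \<rightarrow>\<^bsub>G\<^esub> v" if "v \<in> N r" for r v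
    using that adj_mono[OF _ sub] by (simp add: N_def)
  have N_irrefl: "r \<notin> N r" for r
    using N_adj adj_not_same by blast
  have N_card: "n < card (N r)" if "r \<in> verts H" for r
    using core_degree[OF core that] \<open>n < k\<close> by (simp add: N_def)
  obtain r0 where r0: "r0 \<in> verts H" "r0 \<notin> set c0"
  proof -
    obtain r where "r \<in> verts H"
      using \<open>verts H \<noteq> {}\<close> by blast
    then have "card (set c0) < card (N r)"
      using N_card[of r] c0 card_length[of c0] by (simp add: cop_placement_def)
    then have "\<not> N r \<subseteq> set c0"
      using card_mono[of "set c0" "N r"] by auto
    then show ?thesis
      using that N_verts by blast
  qed
  \<comment> \<open>an uncaptured move inside \<open>H\<close>; one exists if \<open>r\<close> is in \<open>H\<close> and none of the \<open>n\<close> cops was on \<open>r\<close>\<close>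
  define f where "f c r c' = (SOME r'. r' \<in> N r \<and> \<not> captured c c' r r')" for c r c'
  obtain C R where C0: "C 0 = c0" and R0: "R 0 = r0"
    and CSuc: "\<And>t. C (Suc t) = \<sigma> (map (\<lambda>s. (C s, R s)) [0..<Suc t])"
    and RSuc: "\<And>t. R (Suc t) = f (C t) (R t) (C (Suc t))"
    using positions_exist[of c0 r0 \<sigma> f] by blast
  define safe where
    "safe t \<longleftrightarrow> cop_placement G n (C t) \<and> R t \<in> verts H \<and> R t \<notin> set (C t)" for t
  have move: "cop_move G (C t) (C (Suc t)) \<and> R (Suc t) \<in> N (R t) \<and>
      \<not> captured (C t) (C (Suc t)) (R t) (R (Suc t))" if "safe t" for t
  proof -
    have cm: "cop_move G (C t) (C (Suc t))"
      using \<sigma> that vH unfolding legal_strategy_def safe_def CSuc by auto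
    have "\<exists>r'. r' \<in> N (R t) \<and> \<not> captured (C t) (C (Suc t)) (R t) r'"
      using robot_evades_cops[of "C (Suc t)" "C t" "R t" "N (R t)"] cm that N_card[of "R t"]
        N_irrefl[of "R t"] by (auto simp: cop_move_def safe_def cop_placement_def)
    from someI_ex[OF this] show ?thesis
      using cm by (simp add: RSuc f_def)
  qed
  have safe: "safe t" for t
  proof (induction t)
    case 0
    show ?case
      using c0 r0 by (simp add: safe_def C0 R0)
  next
    case (Suc t)
    then show ?case
      using move[OF Suc.IH] cop_placement_cop_move[of n "C t"] N_verts[of "R t"]
      unfolding safe_def captured_def by blast
  qed
  have "play G c0 \<sigma> C R"
    unfolding play_def
  proof (intro conjI allI)
    show "R 0 \<in> verts G"
      using R0 r0 vH by auto
    show "R (Suc t) \<in> closed_nbhd G (R t)" for t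
      using move[OF safe] N_adj by (simp add: closed_nbhd_def)
  qed (use C0 CSuc in auto)
  then show False
    using win move[OF safe] by blast
qed

theorem theorem2p4:
  fixes G :: "('a, 'b) pre_digraph" and k :: nat
  assumes "graph G"
    and "connected G"
    and "0 < k"
    and "\<exists>H. is_core k H G"
  shows "k \<le> c_cr G"
proof -
  interpret graph G by (rule assms(1))
  have "cops_win G (c_cr G)"
    unfolding c_cr_def using cops_win_card_verts[OF assms(1)] by (rule LeastI)
  then show ?thesis
    using assms(4) not_cops_win_of_core by (meson not_le)
qed

end
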